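(* Let $X$ be a Fréchet space. Then there is no $A_1$-frequently hypercyclic operator on $X$.
   Context: $\mathbb{N}$ denotes the set of positive integers. An operator on $X$ is a continuous linear map $T:X\to X$. $A_1$ is the matrix $(\alpha_{n,k})$ with $\alpha_{n,k}=e^{k}/\sum_{j=1}^ne^{j}$ for $1\le k\le n$ and $\alpha_{n,k}=0$ for $k>n$. The lower $A_1$-density of $E\subset\mathbb{N}$ is $\underline{d}_{A_1}(E)=\liminf_{n\to\infty}\sum_{k=1}^{+\infty}\alpha_{n,k}\mathbf{1}_E(k)$, where $\mathbf{1}_E$ is the indicator function of $E$. An operator $T$ on $X$ is $A_1$-frequently hypercyclic if there exists $x\in X$ such that for every non-empty open set $U\subset X$ the set $\{n\in\mathbb{N}:T^nx\in U\}$ has positive lower $A_1$-density.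
   Formalization: The Fréchet space X is assumed to be non-zero: on X = {0} the zero operator is A_1-frequently hypercyclic, since the only non-empty open set is X and its return set is all of ℕ, so the statement fails in that single degenerate case. *)

theory Defs
  imports "HOL-Analysis.Analysis"
begin

text \<open>
  A Frechet space is a locally convex topological vector space whose topology is induced by a
  complete translation-invariant metric. The class \<^class>\<open>topological_ab_group_add\<close> makes addition
  and negation continuous and \<^class>\<open>complete_space\<close> makes the topology that of a complete metric.
  The scalars are an arbitrary \<^class>\<open>real_normed_field\<close>; since its norm is multiplicative, it is
  isomorphic to the reals or to the complex numbers (Gelfand--Mazur). Convexity is written out
  because \<^const>\<open>convex\<close> refers to a fixed real scalar multiplication, not to \<open>smul\<close>.
\<close>

locale frechet_space = vector_space smul
  for smul :: "'k::real_normed_field \<Rightarrow> 'a::{topological_ab_group_add, complete_space} \<Rightarrow> 'a" +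
  assumes continuous_scale: "continuous_on UNIV (\<lambda>(c, x). smul c x)"
    and dist_translation: "dist (x + z :: 'a) (y + z) = dist x y"
    and locally_convex: "open U \<Longrightarrow> 0 \<in> U \<Longrightarrow>
      \<exists>V. open V \<and> 0 \<in> V \<and> V \<subseteq> U \<and>
        (\<forall>x\<in>V. \<forall>y\<in>V. \<forall>t::real. 0 \<le> t \<and> t \<le> 1 \<longrightarrow>
          smul (of_real t) x + smul (of_real (1 - t)) y \<in> V)"

definition continuous_operator ::
    "('k::field \<Rightarrow> 'a::{ab_group_add, topological_space} \<Rightarrow> 'a) \<Rightarrow> ('a \<Rightarrow> 'a) \<Rightarrow> bool" where
  "continuous_operator smul T \<longleftrightarrow> Vector_Spaces.linear smul smul T \<and> continuous_on UNIV T"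

definition A\<^sub>1 :: "nat \<Rightarrow> nat \<Rightarrow> real" where
  "A\<^sub>1 n k = (if 1 \<le> k \<and> k \<le> n then exp (real k) / (\<Sum>j=1..n. exp (real j)) else 0)"

text \<open>The columns of a matrix are indexed by the positive integers, whence the shift by
  \<^const>\<open>Suc\<close> in the series over \<open>k \<ge> 1\<close>.\<close>

definition lower_density :: "(nat \<Rightarrow> nat \<Rightarrow> real) \<Rightarrow> nat set \<Rightarrow> ereal" where
  "lower_density A E = liminf (\<lambda>n. ereal (\<Sum>k. A n (Suc k) * indicator E (Suc k)))"

definition frequently_hypercyclic ::
    "(nat \<Rightarrow> nat \<Rightarrow> real) \<Rightarrow> ('a::topological_space \<Rightarrow> 'a) \<Rightarrow> bool" where
  "frequently_hypercyclic A T \<longleftrightarrow>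
     (\<exists>x. \<forall>U. open U \<and> U \<noteq> {} \<longrightarrow> lower_density A {n. 1 \<le> n \<and> (T ^^ n) x \<in> U} > 0)"

end

theory Submission
  imports Defs
begin

text \<open>
  The weights of \<^const>\<open>A\<^sub>1\<close> grow geometrically, so the \<open>n\<close>-th mean of a set is governed by its last
  element up to \<open>n\<close>: a gap of length \<open>L\<close> ending at \<open>n\<close> forces this mean to be at most \<open>exp (-L)\<close>.
  A set of positive lower density therefore has bounded gaps
  (\<open>positive_lower_density_bounded_gaps\<close>).

  On a Hausdorff space with more than one point, no orbit of a continuous map with a fixed point,
  here \<open>0\<close>, visits every nonempty open set with bounded gaps. Indeed, choose \<open>V\<close> open, nonempty and disjoint from a neighbourhood of \<open>0\<close>, and
  let \<open>L\<close> bound the gaps between the visits to \<open>V\<close>. If the orbit comes close enough to \<open>0\<close>,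
  continuity of the first \<open>L\<close> iterates keeps it near \<open>0\<close> for \<open>L\<close> further steps, so that it misses
  \<open>V\<close> for too long. Hence frequent visits to \<open>V\<close> keep the orbit eventually out of some neighbourhood
  of \<open>0\<close> (\<open>bounded_gap_visits_keep_orbit_off_fixed_point\<close>), which it should visit frequently as well.
\<close>

text \<open>Shifting by \<open>L\<close> multiplies the weights by \<open>exp L\<close>; the weights of \<open>1, \<dots>, p\<close>, which are all that
  is left to a set that avoids \<open>p + 1, \<dots>, p + L\<close>, thus carry at most the fraction \<open>exp (-L)\<close> of the
  total weight of \<open>1, \<dots>, p + L\<close>.\<close>

lemma A\<^sub>1_mean_after_gap:
  assumes gap: "\<And>k. p < k \<Longrightarrow> k \<le> p + L \<Longrightarrow> k \<notin> E"
  shows "(\<Sum>k. A\<^sub>1 (p + L) (Suc k) * indicator E (Suc k)) \<le> exp (- real L)"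
proof -
  define S where "S = (\<Sum>j=1..p+L. exp (real j))"
  have S_ge: "S \<ge> exp (real L) * (\<Sum>k<p. exp (real (Suc k)))"
  proof -
    have "exp (real L) * (\<Sum>k<p. exp (real (Suc k))) = (\<Sum>k<p. exp (real (Suc k + L)))"
      by (simp add: sum_distrib_left exp_add[symmetric] algebra_simps)
    also have "\<dots> = (\<Sum>j\<in>(\<lambda>k. Suc k + L) ` {..<p}. exp (real j))"
      by (subst sum.reindex) (auto simp: inj_on_def)
    also have "\<dots> \<le> S"
      unfolding S_def by (rule sum_mono2) auto
    finally show ?thesis .
  qed
  have "(\<Sum>k. A\<^sub>1 (p + L) (Suc k) * indicator E (Suc k))
      = (\<Sum>k<p. A\<^sub>1 (p + L) (Suc k) * indicator E (Suc k))"
  proof (rule suminf_finite)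
    show "A\<^sub>1 (p + L) (Suc k) * indicator E (Suc k) = 0" if "k \<notin> {..<p}" for k
      using that gap[of "Suc k"] by (cases "Suc k \<le> p + L") (auto simp: A\<^sub>1_def)
  qed simp
  also have "\<dots> \<le> (\<Sum>k<p. exp (real (Suc k)) / S)"
  proof (rule sum_mono)
    fix k assume "k \<in> {..<p}"
    then have "A\<^sub>1 (p + L) (Suc k) = exp (real (Suc k)) / S"
      by (simp add: A\<^sub>1_def S_def)
    moreover have "0 \<le> S"
      unfolding S_def by (intro sum_nonneg) simp
    ultimately show "A\<^sub>1 (p + L) (Suc k) * indicator E (Suc k) \<le> exp (real (Suc k)) / S"
      by (simp add: indicator_def)
  qed
  also have "\<dots> = (\<Sum>k<p. exp (real (Suc k))) / S"
    by (simp add: sum_divide_distrib)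
  also have "\<dots> \<le> exp (- real L)"
  proof (cases "p = 0")
    case False
    have "S > 0"
      unfolding S_def using False by (intro sum_pos) auto
    then show ?thesis
      using S_ge by (simp add: exp_minus field_simps)
  qed simp
  finally show ?thesis .
qed

lemma positive_lower_density_bounded_gaps:
  assumes "lower_density A\<^sub>1 E > 0"
  shows "\<exists>N L. \<forall>n\<ge>N. \<exists>k\<in>E. n < k \<and> k \<le> n + L"
proof -
  obtain c where "0 < ereal c" and c: "ereal c < lower_density A\<^sub>1 E"
    using ereal_dense2[OF assms] by blast
  then have "0 < c" by simp
  obtain N where N: "\<And>n. n \<ge> N \<Longrightarrow> c < (\<Sum>k. A\<^sub>1 n (Suc k) * indicator E (Suc k))"
    using less_LiminfD[OF c[unfolded lower_density_def]]
    by (auto simp: eventually_sequentially)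
  obtain L :: nat where L: "- ln c \<le> real L"
    using real_arch_simple by blast
  have "exp (- real L) \<le> exp (ln c)"
    using L by simp
  then have "exp (- real L) \<le> c"
    using \<open>0 < c\<close> by simp
  then have "\<exists>k\<in>E. n < k \<and> k \<le> n + L" if "n \<ge> N" for n
    using N[of "n + L"] A\<^sub>1_mean_after_gap[of n L E] that by fastforce
  then show ?thesis by blast
qed

lemma continuous_on_funpow:
  fixes T :: "'a::topological_space \<Rightarrow> 'a"
  assumes "continuous_on UNIV T"
  shows "continuous_on UNIV (T ^^ n)"
proof (induction n)
  case (Suc n)
  then show ?case
    using continuous_on_compose[of UNIV "T ^^ n" T] continuous_on_subset[OF assms]
    by (simp add: o_def)
qed (simp add: id_def)

text \<open>The neighbourhood to avoid consists of the points whose first \<open>L\<close> iterates stay in \<open>W\<close>: a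
  late entry of the orbit into it would be followed by \<open>L\<close> steps in \<open>W\<close>, hence outside \<open>V\<close>.\<close>

lemma bounded_gap_visits_keep_orbit_off_fixed_point:
  fixes T :: "'a::topological_space \<Rightarrow> 'a"
  assumes cont: "continuous_on UNIV T" and fixpoint: "T z = z"
    and "open W" "z \<in> W" and disj: "V \<inter> W = {}"
    and V_visits: "\<And>n. n \<ge> N \<Longrightarrow> \<exists>k. (T ^^ k) x \<in> V \<and> n < k \<and> k \<le> n + L"
  shows "\<exists>G. open G \<and> z \<in> G \<and> (\<forall>n\<ge>N. (T ^^ n) x \<notin> G)"
proof (intro exI conjI allI impI)
  define G where "G = (\<Inter>j\<le>L. (T ^^ j) -` W)"
  show "open G"
    unfolding G_def using continuous_on_funpow[OF cont] \<open>open W\<close>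
    by (intro open_INT) (auto intro: open_vimage)
  have "(T ^^ j) z = z" for j
    by (induction j) (simp_all add: fixpoint)
  then show "z \<in> G"
    using \<open>z \<in> W\<close> by (simp add: G_def)
  show "(T ^^ n) x \<notin> G" if "n \<ge> N" for n
  proof
    assume G: "(T ^^ n) x \<in> G"
    obtain k where k: "(T ^^ k) x \<in> V" "n < k" "k \<le> n + L"
      using V_visits[OF \<open>n \<ge> N\<close>] by blast
    then have "(T ^^ (k - n)) ((T ^^ n) x) \<in> W"
      using G by (simp add: G_def)
    then have "(T ^^ k) x \<in> W"
      using k(2) funpow_add[of "k - n" n T] by simp
    then show False
      using k(1) disj by blast
  qed
qed

theorem proposition3p11:
  fixes smul :: "'k::real_normed_field \<Rightarrow> 'a::{topological_ab_group_add, complete_space} \<Rightarrow> 'a"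
  assumes "frechet_space smul"
    and nontrivial: "\<exists>x::'a. x \<noteq> 0"
  shows "\<not> (\<exists>T. continuous_operator smul T \<and> frequently_hypercyclic A\<^sub>1 T)"
proof
  assume "\<exists>T. continuous_operator smul T \<and> frequently_hypercyclic A\<^sub>1 T"
  then obtain T x where lin: "Vector_Spaces.linear smul smul T" and cont: "continuous_on UNIV T"
    and dens: "\<And>U. open U \<Longrightarrow> U \<noteq> {} \<Longrightarrow> lower_density A\<^sub>1 {n. 1 \<le> n \<and> (T ^^ n) x \<in> U} > 0"
    unfolding continuous_operator_def frequently_hypercyclic_def by blast
  interpret T: Vector_Spaces.linear smul smul T
    by (rule lin)
  have visits: "\<exists>N L. \<forall>n\<ge>N. \<exists>k. (T ^^ k) x \<in> U \<and> n < k \<and> k \<le> n + L"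
    if "open U" and "U \<noteq> {}" for U
  proof -
    have "\<exists>N L. \<forall>n\<ge>N. \<exists>k\<in>{n. 1 \<le> n \<and> (T ^^ n) x \<in> U}. n < k \<and> k \<le> n + L"
      by (rule positive_lower_density_bounded_gaps[OF dens[OF that]])
    then obtain N L where
      "\<forall>n\<ge>N. \<exists>k\<in>{n. 1 \<le> n \<and> (T ^^ n) x \<in> U}. n < k \<and> k \<le> n + L"
      by (elim exE)
    then have "\<forall>n\<ge>N. \<exists>k. (T ^^ k) x \<in> U \<and> n < k \<and> k \<le> n + L"
      by blast
    then show ?thesis by (intro exI)
  qed
  obtain y :: 'a where "y \<noteq> 0"
    using nontrivial by blast
  from hausdorff[OF this] obtain V W
    where VW: "open V" "open W" "y \<in> V" "0 \<in> W" "V \<inter> W = {}"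
    by (elim exE conjE)
  then have "V \<noteq> {}" by blast
  obtain N L where V: "\<forall>n\<ge>N. \<exists>k. (T ^^ k) x \<in> V \<and> n < k \<and> k \<le> n + L"
    using visits[OF \<open>open V\<close> \<open>V \<noteq> {}\<close>] by (elim exE)
  have "\<exists>G. open G \<and> 0 \<in> G \<and> (\<forall>n\<ge>N. (T ^^ n) x \<notin> G)"
    by (rule bounded_gap_visits_keep_orbit_off_fixed_point
          [OF cont T.zero VW(2,4,5) V[rule_format]])
  then obtain G where "open G" "0 \<in> G" and G: "\<forall>n\<ge>N. (T ^^ n) x \<notin> G"
    by (elim exE conjE)
  then have "G \<noteq> {}" by blast
  obtain N' L' where "\<forall>n\<ge>N'. \<exists>k. (T ^^ k) x \<in> G \<and> n < k \<and> k \<le> n + L'"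
    using visits[OF \<open>open G\<close> \<open>G \<noteq> {}\<close>] by (elim exE)
  then obtain k where "(T ^^ k) x \<in> G" "max N N' < k"
    by (meson max.cobounded2)
  then show False
    using G by simp
qed

end
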